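(* Consider the constrained mechanical system $$M(q)\ddot q+C(q,\dot q)\dot q=f_g(q)+f_c+f,\qquad A(q)\dot q=0,\qquad f=B(q)u,$$ with $q\in\mathbb{R}^n$, and let $q^*$ be a desired configuration. Let $P$ be the orthogonal projection onto the null space $\mathcal N(A)$, and suppose that the condition $$\mathcal R(PB)=\mathcal N(A)\quad\text{or}\quad \mathcal N(A)\subseteq\mathcal R(B)$$ holds. Suppose the control law $$f=-R(q)\Big(f_g(q)+K_p\big(e+\sigma\|e\|\eta\big)+K_d\dot q\Big),\qquad e=q-q^*,$$ is applied to the system, where $K_p>0$ and $K_d>0$ are positive scalar gains, $\sigma>1$ is a constant scalar, $$R=B(B^TPB)^{-1}B^TP,$$ and $\eta=\dot q/\|\dot q\|$ if $\|\dot q\|\neq0$, $\eta=\xi$ otherwise, with $\xi$ a constant unit vector in $\mathcal N(A)$. Then $q\to q^*$ and $\dot q\to0$ as $t\to\infty$.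
   Context: $M(q)\in\mathbb{R}^{n\times n}$ is the symmetric positive-definite inertia matrix, $C(q,\dot q)\in\mathbb{R}^{n\times n}$ contains the Coriolis and centrifugal terms, with $\dot M-2C$ skew-symmetric, $A(q)\in\mathbb{R}^{m\times n}$ is the constraint matrix (possibly rank-deficient, with rank possibly depending on $q$), $f_g(q)\in\mathbb{R}^n$ is the gravitational generalized force, $f_c\in\mathcal N(A)^\perp$ is the generalized constraint force, $f\in\mathbb{R}^n$ is the generalized input force, $u\in\mathbb{R}^k$ is the actuation force and $B(q)\in\mathbb{R}^{n\times k}$. $\mathcal N$ and $\mathcal R$ denote null space and range, $\|\cdot\|$ is the Euclidean norm, and dots denote time derivatives. $P$ satisfies $\mathcal R(P)=\mathcal N(A)$, $P^2=P=P^T$; the choice of $\eta$ gives $P\eta=\eta$ and $\|\eta\|=1$. *)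

theory Defs
  imports "HOL-Analysis.Analysis"
begin

definition null_space :: "real^'n^'m \<Rightarrow> (real^'n) set" where
  "null_space A = {x. A *v x = 0}"

definition range_space :: "real^'n^'m \<Rightarrow> (real^'m) set" where
  "range_space A = range ((*v) A)"

definition skew_symmetric :: "real^'n^'n \<Rightarrow> bool" where
  "skew_symmetric X \<longleftrightarrow> transpose X = - X"

definition sym_pos_def :: "real^'n^'n \<Rightarrow> bool" where
  "sym_pos_def X \<longleftrightarrow> transpose X = X \<and> (\<forall>x. x \<noteq> 0 \<longrightarrow> x \<bullet> (X *v x) > 0)"

definition is_null_projection :: "real^'n^'m \<Rightarrow> real^'n^'n \<Rightarrow> bool" where
  "is_null_projection A P \<longleftrightarrow>
     range_space P = null_space A \<and> P ** P = P \<and> transpose P = P"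

text \<open>By the chain rule, \<open>matrix_rate M q v\<close> is the time derivative of \<open>M (q t)\<close> along a
  motion that passes through \<open>q\<close> with velocity \<open>v\<close>. It is meaningful only where \<open>M\<close> is
  differentiable.\<close>

definition matrix_rate :: "(real^'n \<Rightarrow> real^'n^'n) \<Rightarrow> real^'n \<Rightarrow> real^'n \<Rightarrow> real^'n^'n" where
  "matrix_rate M q v = frechet_derivative M (at q) v"

definition eta :: "real^'n \<Rightarrow> real^'n \<Rightarrow> real^'n" where
  "eta \<xi> v = (if norm v \<noteq> 0 then (1 / norm v) *\<^sub>R v else \<xi>)"

text \<open>\<open>matrix_inv\<close> is an unspecified matrix for a singular argument, so the following two
  definitions are meaningful only if \<open>transpose B ** P ** B\<close> is invertible.\<close>

definition R_matrix :: "real^'k^'n \<Rightarrow> real^'n^'n \<Rightarrow> real^'n^'n" where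
  "R_matrix B P = B ** matrix_inv (transpose B ** P ** B) ** transpose B ** P"

text \<open>Arguments: \<open>fg\<close> is the gravitational force at the current configuration, \<open>e\<close> the
  configuration error and \<open>v\<close> the velocity.\<close>

definition control_law ::
  "real^'k^'n \<Rightarrow> real^'n^'n \<Rightarrow> real \<Rightarrow> real \<Rightarrow> real \<Rightarrow> real^'n \<Rightarrow> real^'n \<Rightarrow> real^'n \<Rightarrow> real^'n \<Rightarrow> real^'n"
where
  "control_law B P Kp Kd \<sigma> \<xi> fg e v =
     - (R_matrix B P *v (fg + Kp *\<^sub>R (e + (\<sigma> * norm e) *\<^sub>R eta \<xi> v) + Kd *\<^sub>R v))"

end

theory Submission
  imports Defs
begin

text \<open>
  Any vector \<open>w\<close> of the null space satisfies \<open>w \<bullet> R z = w \<bullet> z\<close>, so pairing the closed loop with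
  \<open>w\<close> removes the constraint force and the gravity. Pairing with the velocity \<open>v\<close> shows that
  the kinetic energy decays at least at the rate \<open>(Kp (\<sigma> - 1) \<parallel>e\<parallel> + Kd \<parallel>v\<parallel>) \<parallel>v\<parallel>\<close>.
  If \<open>v\<close> vanishes at some time, it vanishes from then on, and pairing with \<open>\<xi>\<close> gives \<open>e = 0\<close>.
  Otherwise the square root \<open>s\<close> of the energy stays positive although its derivative is at most
  \<open>- \<alpha> \<parallel>e\<parallel> - \<beta> \<parallel>v\<parallel>\<close>, where \<open>s\<close> is bounded by a multiple of \<open>\<parallel>v\<parallel>\<close>. Hence \<open>s\<close> tends to
  zero, the remaining path length tends to zero, and \<open>e\<close> cannot stay away from zero.
\<close>

section \<open>Scalar comparison and decay estimates\<close>

lemma derivative_le_imp_diff_le: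
  fixes f f' :: "real \<Rightarrow> real"
  assumes f: "\<And>t. t \<ge> 0 \<Longrightarrow> (f has_real_derivative f' t) (at t within {0..})"
    and ab: "0 \<le> a" "a \<le> b"
    and le: "\<And>t. a \<le> t \<Longrightarrow> t \<le> b \<Longrightarrow> f' t \<le> c"
  shows "f b - f a \<le> c * (b - a)"
proof (cases "a = b")
  case False
  have "(f has_derivative (*) (f' x)) (at x within {a..b})" if "a \<le> x" "x \<le> b" for x
    using has_field_derivative_subset[OF f, of x "{a..b}"] that ab
    by (auto simp: has_field_derivative_def)
  then obtain x where x: "x \<in> {a<..<b}" "f b - f a = f' x * (b - a)"
    using mvt_simple[of a b f "\<lambda>x. (*) (f' x)"] False ab by auto
  then show ?thesis
    using le[of x] by (simp add: mult_right_mono)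
qed simp

lemma not_pos_if_derivative_le_neg:
  fixes f f' :: "real \<Rightarrow> real"
  assumes f: "\<And>t. t \<ge> 0 \<Longrightarrow> (f has_real_derivative f' t) (at t within {0..})"
    and T: "0 \<le> T" and c: "c > 0"
    and le: "\<And>t. T \<le> t \<Longrightarrow> f' t \<le> - c"
  shows "\<exists>t \<ge> T. f t \<le> 0"
proof -
  \<comment> \<open>The line through \<open>f T\<close> with slope \<open>- c\<close>, an upper
    bound for \<open>f\<close>, has come down to \<open>f T - \<bar>f T\<bar>\<close> at this time,
    which is at most zero.\<close>
  define b where "b = T + \<bar>f T\<bar> / c"
  have b: "T \<le> b" "c * (b - T) = \<bar>f T\<bar>"
    using c by (auto simp: b_def)
  have "f b - f T \<le> - c * (b - T)"
    by (rule derivative_le_imp_diff_le[OF f T b(1)]) (use le in auto)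
  then show ?thesis
    using b by (intro exI[of _ b]) auto
qed

text \<open>Positivity of \<open>s\<close> turns any permanent lower bound on the dissipation into a
  contradiction. As \<open>upper\<close> keeps the speed above \<open>s / k\<close>, the \<beta>
  term forces \<open>s\<close> to zero. The same term makes the remaining displacement small once
  \<open>s\<close> is small, and the \<alpha> term then excludes an \<open>e\<close> that remains
  far from zero.\<close>

lemma dissipation_tendsto_zero:
  fixes e v :: "real \<Rightarrow> 'a::real_inner" and s s' :: "real \<Rightarrow> real"
  assumes e: "\<And>t. t \<ge> 0 \<Longrightarrow> (e has_vector_derivative v t) (at t within {0..})"
    and s: "\<And>t. t \<ge> 0 \<Longrightarrow> (s has_real_derivative s' t) (at t within {0..})"
    and pos: "\<And>t. t \<ge> 0 \<Longrightarrow> s t > 0"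
    and coeffs: "\<alpha> > 0" "\<beta> > 0" "k > 0"
    and decay: "\<And>t. t \<ge> 0 \<Longrightarrow> s' t \<le> - \<alpha> * norm (e t) - \<beta> * norm (v t)"
    and upper: "\<And>t. t \<ge> 0 \<Longrightarrow> s t \<le> k * norm (v t)"
  shows "(s \<longlongrightarrow> 0) at_top" "(e \<longlongrightarrow> 0) at_top"
proof -
  have an: "0 \<le> \<alpha> * norm (e t)" and bn: "0 \<le> \<beta> * norm (v t)" for t
    using coeffs by simp_all
  have s'0: "s' t \<le> 0" if "t \<ge> 0" for t
    using decay[OF that] an[of t] bn[of t] by linarith
  have mono: "s b \<le> s a" if "0 \<le> a" "a \<le> b" for a b
    using derivative_le_imp_diff_le[OF s that, of 0] s'0 that by auto
  have small: "\<exists>T\<ge>0. s T < \<epsilon>" if \<epsilon>: "\<epsilon> > 0" for \<epsilon>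
  proof (rule ccontr)
    assume "\<not> ?thesis"
    then have ge: "s t \<ge> \<epsilon>" if "t \<ge> 0" for t
      using that by force
    have "s' t \<le> - (\<beta> * (\<epsilon> / k))" if "t \<ge> 0" for t
    proof -
      have "\<epsilon> / k \<le> norm (v t)"
        using ge[OF that] upper[OF that] coeffs by (simp add: field_simps)
      then have "\<beta> * (\<epsilon> / k) \<le> \<beta> * norm (v t)"
        using coeffs by (intro mult_left_mono) auto
      then show ?thesis
        using decay[OF that] an[of t] by linarith
    qed
    then have "\<exists>t\<ge>0. s t \<le> 0"
      using \<epsilon> coeffs by (intro not_pos_if_derivative_le_neg[OF s, of 0 "\<beta> * (\<epsilon> / k)"]) auto
    then show False
      using pos by force
  qed
  show "(s \<longlongrightarrow> 0) at_top"
  proof (rule tendstoI)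
    fix \<epsilon> :: real assume "\<epsilon> > 0"
    then obtain T where T: "T \<ge> 0" "s T < \<epsilon>"
      using small by blast
    have "dist (s t) 0 < \<epsilon>" if "t \<ge> T" for t
      using mono[of T t] pos[of t] T that by (auto simp: dist_real_def)
    then show "\<forall>\<^sub>F t in at_top. dist (s t) 0 < \<epsilon>"
      by (auto simp: eventually_at_top_linorder)
  qed
  have path: "\<beta> * norm (e b - e a) \<le> s a - s b" if ab: "0 \<le> a" "a \<le> b" for a b
  proof (cases "e b = e a")
    case True
    then show ?thesis using mono[OF ab] by simp
  next
    case False
    \<comment> \<open>Testing the displacement against its own fixed direction \<open>w\<close>
      replaces integration of the speed: by Cauchy-Schwarz, the decay of \<open>norm w * s t\<close>
      dominates the growth of \<open>\<beta> * (e t \<bullet> w)\<close>, so the sum cannot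
      increase.\<close>
    define w where "w = e b - e a"
    have "\<beta> * (e b \<bullet> w) + norm w * s b - (\<beta> * (e a \<bullet> w) + norm w * s a) \<le> 0 * (b - a)"
    proof (rule derivative_le_imp_diff_le[where f = "\<lambda>t. \<beta> * (e t \<bullet> w) + norm w * s t", OF _ ab])
      fix t :: real assume t: "t \<ge> 0"
      have "((\<lambda>t. e t \<bullet> w) has_real_derivative v t \<bullet> w) (at t within {0..})"
        using bounded_linear.has_vector_derivative[OF bounded_linear_inner_left e[OF t]]
        by (simp add: has_real_derivative_iff_has_vector_derivative)
      then show "((\<lambda>t. \<beta> * (e t \<bullet> w) + norm w * s t) has_real_derivative
          (\<beta> * (v t \<bullet> w) + norm w * s' t)) (at t within {0..})"
        by (intro DERIV_add DERIV_cmult s[OF t])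
    next
      fix t assume t: "a \<le> t" "t \<le> b"
      have "\<beta> * (v t \<bullet> w) \<le> \<beta> * (norm (v t) * norm w)"
        using coeffs norm_cauchy_schwarz by (intro mult_left_mono) auto
      moreover have "s' t \<le> - \<beta> * norm (v t)"
        using decay[of t] t ab an[of t] by auto
      then have "norm w * s' t \<le> norm w * (- \<beta> * norm (v t))"
        by (intro mult_left_mono) auto
      ultimately show "\<beta> * (v t \<bullet> w) + norm w * s' t \<le> 0"
        by (simp add: algebra_simps)
    qed
    then have "\<beta> * (w \<bullet> w) \<le> norm w * (s a - s b)"
      by (simp add: w_def algebra_simps)
    then have "norm w * (\<beta> * norm w) \<le> norm w * (s a - s b)"
      by (simp add: dot_square_norm power2_eq_square algebra_simps)
    then show ?thesis
      using False by (simp add: w_def)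
  qed
  show "(e \<longlongrightarrow> 0) at_top"
  proof (rule tendstoI)
    fix \<epsilon> :: real assume \<epsilon>: "\<epsilon> > 0"
    \<comment> \<open>After the \<open>T\<close> chosen below, the error moves by less than
      \<delta>. If it were at least \<open>2 * \<delta>\<close> in norm at \<open>T\<close>, it
      would stay at least \<delta>, which the \<alpha> term forbids; otherwise it stays below
      \<open>3 * \<delta>\<close>.\<close>
    define \<delta> where "\<delta> = \<epsilon> / 3"
    have \<delta>: "\<delta> > 0" using \<epsilon> by (simp add: \<delta>_def)
    then obtain T where T: "T \<ge> 0" "s T < \<beta> * \<delta>"
      using small[of "\<beta> * \<delta>"] coeffs by auto
    have near: "norm (e t - e T) < \<delta>" if "t \<ge> T" for t
    proof -
      have "\<beta> * norm (e t - e T) < \<beta> * \<delta>"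
        using path[of T t] pos[of t] T that by linarith
      then show ?thesis using coeffs by simp
    qed
    have "norm (e T) < 2 * \<delta>"
    proof (rule ccontr)
      assume far: "\<not> ?thesis"
      have "s' t \<le> - (\<alpha> * \<delta>)" if "t \<ge> T" for t
      proof -
        have "\<delta> \<le> norm (e t)"
          using near[OF that] norm_triangle_ineq2[of "e T" "e t"] far
          by (simp add: norm_minus_commute)
        then have "\<alpha> * \<delta> \<le> \<alpha> * norm (e t)"
          using coeffs by (intro mult_left_mono) auto
        then show ?thesis
          using decay[of t] that T bn[of t] by auto
      qed
      then have "\<exists>t\<ge>T. s t \<le> 0"
        using \<delta> coeffs T by (intro not_pos_if_derivative_le_neg[OF s, of T "\<alpha> * \<delta>"]) auto
      then obtain t where "t \<ge> T" "s t \<le> 0"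
        by blast
      then show False
        using pos[of t] T by simp
    qed
    then have "dist (e t) 0 < \<epsilon>" if "t \<ge> T" for t
      using near[OF that] norm_triangle_ineq2[of "e t" "e T"] by (simp add: \<delta>_def)
    then show "\<forall>\<^sub>F t in at_top. dist (e t) 0 < \<epsilon>"
      by (auto simp: eventually_at_top_linorder)
  qed
qed

section \<open>Constraint projection, actuation and quadratic forms\<close>

lemma bounded_bilinear_matrix_vector_mult:
  "bounded_bilinear ((*v) :: real^'n^'m \<Rightarrow> real^'n \<Rightarrow> real^'m)"
  unfolding bilinear_conv_bounded_bilinear[symmetric] bilinear_def
  by (auto intro!: linearI simp: algebra_simps scaleR_matrix_vector_assoc)

lemma null_projection_fixes:
  assumes "is_null_projection A P" "w \<in> null_space A"
  shows "P *v w = w"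
proof -
  obtain y where "w = P *v y"
    using assms by (auto simp: is_null_projection_def range_space_def)
  then show ?thesis
    using assms by (simp add: is_null_projection_def matrix_vector_mul_assoc)
qed

lemma matrix_inv_right_invertible:
  fixes G :: "real^'n^'n"
  assumes "invertible G"
  shows "G ** matrix_inv G = mat 1"
  using assms unfolding invertible_def matrix_inv_def by (metis (mono_tags, lifting) someI_ex)

text \<open>Both alternatives of \<open>actuation\<close> yield \<open>w = P *v (B *v y)\<close>.
  Moving \<open>P\<close> and \<open>B\<close> across the inner product brings
  \<open>transpose B ** P ** B\<close> next to its inverse, which leaves
  \<open>y \<bullet> (transpose B *v (P *v z))\<close>, that is \<open>w \<bullet> z\<close>. Along
  admissible directions the control thus acts as if \<open>R_matrix B P\<close> were the
  identity.\<close>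

lemma inner_R_matrix:
  fixes A :: "real^'n^'m" and B :: "real^'k^'n"
  assumes P: "is_null_projection A P"
    and actuation: "range_space (P ** B) = null_space A \<or> null_space A \<subseteq> range_space B"
    and inv: "invertible (transpose B ** P ** B)"
    and w: "w \<in> null_space A"
  shows "w \<bullet> (R_matrix B P *v z) = w \<bullet> z"
proof -
  have Pw: "P *v w = w"
    using null_projection_fixes[OF P w] .
  obtain y where y: "w = P *v (B *v y)"
    using actuation
  proof
    assume "range_space (P ** B) = null_space A"
    then show ?thesis
      using that w by (auto simp: range_space_def matrix_vector_mul_assoc)
  next
    assume "null_space A \<subseteq> range_space B"
    then obtain y where "w = B *v y"
      using w by (auto simp: range_space_def)
    then show ?thesis
      using that Pw by metis
  qed
  have adj: "x \<bullet> (transpose X *v z) = (X *v x) \<bullet> z" for X :: "real^'a^'b" and x z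
    by (metis dot_lmul_matrix inner_commute transpose_matrix_vector)
  have "transpose P = P"
    using P by (simp add: is_null_projection_def)
  then have Padj: "x \<bullet> (P *v z) = (P *v x) \<bullet> z" for x z
    using adj[of x P z] by (simp only:)
  define G where "G = transpose B ** P ** B"
  have "w \<bullet> (R_matrix B P *v z) =
      (B *v y) \<bullet> (P *v (B *v (matrix_inv G *v (transpose B *v (P *v z)))))"
    unfolding Padj y R_matrix_def G_def by (simp add: matrix_vector_mul_assoc matrix_mul_assoc)
  also have "\<dots> = y \<bullet> (G *v (matrix_inv G *v (transpose B *v (P *v z))))"
    unfolding adj[symmetric] G_def by (simp only: matrix_vector_mul_assoc matrix_mul_assoc)
  also have "\<dots> = y \<bullet> (transpose B *v (P *v z))"
    using matrix_inv_right_invertible[of G] inv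
    by (simp only: matrix_vector_mul_assoc[of G] G_def[symmetric] matrix_vector_mul_lid)
  also have "\<dots> = w \<bullet> z"
    unfolding adj Padj y ..
  finally show ?thesis .
qed

text \<open>Transposing the matrix leaves its quadratic form unchanged, so here the form equals its
  own negative.\<close>

lemma inner_skew_symmetric:
  fixes X :: "real^'n^'n"
  assumes "skew_symmetric X"
  shows "x \<bullet> (X *v x) = 0"
proof -
  have "x \<bullet> (X *v x) = (transpose X *v x) \<bullet> x"
    by (simp add: dot_lmul_matrix)
  also have "\<dots> = - ((X *v x) \<bullet> x)"
    using assms by (simp add: skew_symmetric_def bounded_bilinear.minus_left[OF bounded_bilinear_matrix_vector_mult])
  finally show ?thesis by (simp add: inner_commute)
qed

text \<open>The extrema over the compact product of \<open>S\<close> and the unit sphere serve as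
  constants uniform in \<open>x\<close>. Homogeneity of degree two in \<open>v\<close> extends the
  bounds to all vectors, and definiteness makes the minimum, hence also the maximum,
  positive.\<close>

lemma quadratic_form_bounds:
  fixes M :: "'a::topological_space \<Rightarrow> real^'n^'n"
  assumes S: "compact S" "S \<noteq> {}" and M: "continuous_on S M"
    and pd: "\<And>x. x \<in> S \<Longrightarrow> sym_pos_def (M x)"
  obtains m k where "m > 0" "k > 0"
    "\<And>x v. x \<in> S \<Longrightarrow> m * (norm v)\<^sup>2 \<le> v \<bullet> (M x *v v)"
    "\<And>x v. x \<in> S \<Longrightarrow> v \<bullet> (M x *v v) \<le> k * (norm v)\<^sup>2"
proof -
  define K where "K = S \<times> sphere (0::real^'n) 1"
  define g where "g = (\<lambda>p. snd p \<bullet> (M (fst p) *v snd p))"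
  have K: "compact K" "K \<noteq> {}"
    using S unfolding K_def by (auto intro: compact_Times)
  have "continuous_on K (\<lambda>p. M (fst p))"
    by (rule continuous_on_compose2[OF M]) (auto simp: K_def intro: continuous_intros)
  then have g: "continuous_on K g"
    unfolding g_def
    by (intro continuous_intros bounded_bilinear.continuous_on[OF bounded_bilinear_matrix_vector_mult])
  obtain p where p: "p \<in> K" "\<And>y. y \<in> K \<Longrightarrow> g p \<le> g y"
    using continuous_attains_inf[OF K g] by blast
  obtain r where r: "r \<in> K" "\<And>y. y \<in> K \<Longrightarrow> g y \<le> g r"
    using continuous_attains_sup[OF K g] by blast
  have gp: "g p > 0"
  proof -
    have "fst p \<in> S" "snd p \<noteq> 0"
      using p(1) by (auto simp: K_def mem_Times_iff)
    then show ?thesis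
      using pd unfolding g_def sym_pos_def_def by blast
  qed
  have scale: "v \<bullet> (M x *v v) = g (x, v /\<^sub>R norm v) * (norm v)\<^sup>2" if "v \<noteq> 0" for x v
    using that by (simp add: g_def matrix_vector_mult_scaleR power2_eq_square field_simps)
  show ?thesis
  proof (rule that[of "g p" "g r"])
    show "g r > 0" using gp p(2)[OF r(1)] by simp
    fix x v assume x: "x \<in> S"
    have mem: "(x, v /\<^sub>R norm v) \<in> K" if "v \<noteq> 0"
      using x that by (simp add: K_def)
    show "g p * (norm v)\<^sup>2 \<le> v \<bullet> (M x *v v)"
      using scale[of v x] mem p(2) by (cases "v = 0") (auto intro: mult_right_mono)
    show "v \<bullet> (M x *v v) \<le> g r * (norm v)\<^sup>2"
      using scale[of v x] mem r(2) by (cases "v = 0") (auto intro: mult_right_mono)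
  qed (rule gp)
qed

section \<open>Convergence of the closed loop\<close>

theorem theorem2:
  fixes M :: "real^'n \<Rightarrow> real^'n^'n"
    and C :: "real^'n \<Rightarrow> real^'n \<Rightarrow> real^'n^'n"
    and A :: "real^'n \<Rightarrow> real^'n^'m"
    and B :: "real^'n \<Rightarrow> real^'k^'n"
    and P :: "real^'n \<Rightarrow> real^'n^'n"
    and fg :: "real^'n \<Rightarrow> real^'n"
    and Kp Kd \<sigma> :: real
    and \<xi> qstar :: "real^'n"
    and q qd qdd fc f :: "real \<Rightarrow> real^'n"
    and u :: "real \<Rightarrow> real^'k"
  assumes inertia: "\<And>x. sym_pos_def (M x)" "\<And>x. M differentiable (at x)"
    and coriolis: "\<And>x v. skew_symmetric (matrix_rate M x v - 2 *\<^sub>R C x v)"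
    and projection: "\<And>x. is_null_projection (A x) (P x)"
    and actuation: "\<And>x. range_space (P x ** B x) = null_space (A x)
                       \<or> null_space (A x) \<subseteq> range_space (B x)"
    and gains: "Kp > 0" "Kd > 0" "\<sigma> > 1"
    and velocity: "\<And>t. t \<ge> 0 \<Longrightarrow> (q has_vector_derivative qd t) (at t within {0..})"
    and acceleration: "\<And>t. t \<ge> 0 \<Longrightarrow> (qd has_vector_derivative qdd t) (at t within {0..})"
    and dynamics: "\<And>t. t \<ge> 0 \<Longrightarrow>
          M (q t) *v qdd t + C (q t) (qd t) *v qd t = fg (q t) + fc t + f t"
    and constraint: "\<And>t. t \<ge> 0 \<Longrightarrow> A (q t) *v qd t = 0"
    and constraint_force: "\<And>t. t \<ge> 0 \<Longrightarrow> fc t \<in> orthogonal_comp (null_space (A (q t)))"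
    and input_force: "\<And>t. t \<ge> 0 \<Longrightarrow> f t = B (q t) *v u t"
    and well_defined:
      "\<And>t. t \<ge> 0 \<Longrightarrow> invertible (transpose (B (q t)) ** P (q t) ** B (q t))"
    and control: "\<And>t. t \<ge> 0 \<Longrightarrow>
          f t = control_law (B (q t)) (P (q t)) Kp Kd \<sigma> \<xi> (fg (q t)) (q t - qstar) (qd t)"
    and xi: "norm \<xi> = 1" "\<And>t. t \<ge> 0 \<Longrightarrow> qd t = 0 \<Longrightarrow> \<xi> \<in> null_space (A (q t))"
  shows "(q \<longlongrightarrow> qstar) at_top \<and> (qd \<longlongrightarrow> 0) at_top"
proof -
  define e where "e t = q t - qstar" for t
  have e: "(e has_vector_derivative qd t) (at t within {0..})" if "t \<ge> 0" for t
    unfolding e_def using has_vector_derivative_diff[OF velocity[OF that] has_vector_derivative_const]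
    by simp
  have vnull: "qd t \<in> null_space (A (q t))" if "t \<ge> 0" for t
    using constraint[OF that] by (simp add: null_space_def)

  \<comment> \<open>\<open>w\<close> is kept free: the velocity gives the energy balance, while
    \<xi> yields information at rest, where pairing with the velocity gives none.\<close>
  have paired: "w \<bullet> (M (q t) *v qdd t + C (q t) (qd t) *v qd t) =
      - (Kp * (w \<bullet> e t + \<sigma> * norm (e t) * (w \<bullet> eta \<xi> (qd t))) + Kd * (w \<bullet> qd t))"
    if t: "t \<ge> 0" and w: "w \<in> null_space (A (q t))" for t w
  proof -
    have "w \<bullet> fc t = 0"
      using constraint_force[OF t] w by (auto simp: orthogonal_comp_def orthogonal_def)
    moreover have "w \<bullet> f t = - (w \<bullet> (fg (q t) + Kp *\<^sub>R (e t + (\<sigma> * norm (e t)) *\<^sub>R eta \<xi> (qd t)) + Kd *\<^sub>R qd t))"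
      unfolding control[OF t] control_law_def inner_minus_right e_def
      by (subst inner_R_matrix[OF projection actuation well_defined[OF t] w]) simp
    ultimately show ?thesis
      unfolding dynamics[OF t] by (simp add: inner_add_right algebra_simps)
  qed

  \<comment> \<open>\<open>V\<close> is twice the kinetic energy, hence the factor 2 in its
    derivative. \<open>D\<close> is the negated right side of \<open>paired\<close> for
    \<open>w = qd t\<close>.\<close>
  define V where "V t = qd t \<bullet> (M (q t) *v qd t)" for t
  define D where "D t = Kp * (qd t \<bullet> e t + \<sigma> * norm (e t) * norm (qd t)) + Kd * (norm (qd t))\<^sup>2" for t
  have V: "(V has_real_derivative - 2 * D t) (at t within {0..})" if t: "t \<ge> 0" for t
  proof -
    let ?v = "qd t" and ?M' = "matrix_rate M (q t) (qd t)"
    have "(M has_derivative frechet_derivative M (at (q t))) (at (q t))"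
      using inertia(2) frechet_derivative_works by blast
    then have "((\<lambda>t. M (q t)) has_derivative (\<lambda>h. frechet_derivative M (at (q t)) (h *\<^sub>R ?v))) (at t within {0..})"
      using has_derivative_compose[OF velocity[OF t, unfolded has_vector_derivative_def]] by blast
    moreover have "linear (frechet_derivative M (at (q t)))"
      using inertia(2) linear_frechet_derivative by blast
    ultimately have M': "((\<lambda>t. M (q t)) has_vector_derivative ?M') (at t within {0..})"
      by (simp add: has_vector_derivative_def matrix_rate_def linear_cmul)
    have "((\<lambda>t. M (q t) *v qd t) has_vector_derivative M (q t) *v qdd t + ?M' *v ?v) (at t within {0..})"
      using bounded_bilinear.has_vector_derivative[OF bounded_bilinear_matrix_vector_mult M' acceleration[OF t]] .
    then have V': "(V has_real_derivative ?v \<bullet> (M (q t) *v qdd t + ?M' *v ?v) + qdd t \<bullet> (M (q t) *v ?v)) (at t within {0..})"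
      unfolding V_def has_real_derivative_iff_has_vector_derivative
      using bounded_bilinear.has_vector_derivative[OF bounded_bilinear_inner acceleration[OF t]] by blast
    \<comment> \<open>Symmetry of the inertia matrix merges the two acceleration terms, and
      skew-symmetry trades the matrix rate for twice the Coriolis term. The derivative of
      \<open>V\<close> is thus twice the velocity paired with the equation of motion.\<close>
    have "qdd t \<bullet> (M (q t) *v ?v) = ?v \<bullet> (M (q t) *v qdd t)"
      using inertia(1)[of "q t"] unfolding sym_pos_def_def
      by (metis dot_lmul_matrix inner_commute transpose_matrix_vector)
    moreover have "?v \<bullet> (?M' *v ?v) = 2 * (?v \<bullet> (C (q t) ?v *v ?v))"
      using inner_skew_symmetric[OF coriolis[of "q t" ?v], of ?v]
      by (simp add: matrix_vector_mult_diff_rdistrib inner_diff_right scaleR_matrix_vector_assoc[symmetric])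
    \<comment> \<open>At zero velocity both sides vanish, whatever \<xi> is.\<close>
    moreover have "?v \<bullet> eta \<xi> ?v = norm ?v"
      by (simp add: eta_def dot_square_norm power2_eq_square)
    then have "?v \<bullet> (M (q t) *v qdd t + C (q t) ?v *v ?v) = - D t"
      unfolding paired[OF t vnull[OF t]] D_def by (simp add: dot_square_norm)
    ultimately have "?v \<bullet> (M (q t) *v qdd t + ?M' *v ?v) + qdd t \<bullet> (M (q t) *v ?v) = - 2 * D t"
      by (simp add: inner_add_right)
    with V' show ?thesis
      by (simp only:)
  qed
  \<comment> \<open>Even with the error directly opposed to the velocity,
    \<open>qd t \<bullet> e t\<close> costs only \<open>norm (e t) * norm (qd t)\<close>; the
    \<sigma> term outweighs it with surplus \<open>\<sigma> - 1\<close>.\<close>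
  have D_ge: "D t \<ge> (Kp * (\<sigma> - 1) * norm (e t) + Kd * norm (qd t)) * norm (qd t)" for t
  proof -
    have "- (norm (qd t) * norm (e t)) \<le> qd t \<bullet> e t"
      using Cauchy_Schwarz_ineq2[of "qd t" "e t"] by linarith
    then have "Kp * (- (norm (qd t) * norm (e t)) + \<sigma> * norm (e t) * norm (qd t)) \<le>
        Kp * (qd t \<bullet> e t + \<sigma> * norm (e t) * norm (qd t))"
      using gains by (intro mult_left_mono) auto
    then show ?thesis
      unfolding D_def by (simp add: algebra_simps power2_eq_square)
  qed
  have D_nonneg: "D t \<ge> 0" for t
    by (rule order_trans[OF _ D_ge]) (use gains in auto)
  have V_mono: "V b \<le> V a" if "0 \<le> a" "a \<le> b" for a b
    using derivative_le_imp_diff_le[OF V that, of 0] D_nonneg by auto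
  have V_pos: "V t > 0" if "qd t \<noteq> 0" for t
    using inertia(1) that unfolding V_def sym_pos_def_def by blast

  show ?thesis
  \<comment> \<open>The derivative formula for \<open>sqrt (V t)\<close> needs
    \<open>V t > 0\<close>, so a motion that ever comes to rest is treated separately.\<close>
  proof (cases "\<exists>T\<ge>0. qd T = 0")
    case True
    then obtain T where T: "T \<ge> 0" "qd T = 0" by blast
    have v0: "qd t = 0" if "t \<ge> T" for t
      using V_mono[of T t] V_pos[of t] T that by (force simp: V_def)
    \<comment> \<open>The strict inequality provides a two-sided neighbourhood in which
      \<open>qd\<close> vanishes, so \<open>qdd t\<close> is zero. Pairing with \<xi> then leaves
      \<open>\<xi> \<bullet> e t = - \<sigma> * norm (e t)\<close>, which Cauchy-Schwarz and
      \<open>\<sigma> > 1\<close> allow only for zero error.\<close>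
    have e0: "e t = 0" if t: "t > T" for t
    proof -
      have t0: "t \<ge> 0" using T t by simp
      have "(qd has_vector_derivative qdd t) (at t)"
        using acceleration[OF t0] at_within_interior[of t "{0..}"] T t by simp
      then have "((\<lambda>t. 0) has_vector_derivative qdd t) (at t)"
        by (rule has_vector_derivative_transform_within_open[of _ _ _ "{T<..}"]) (use t v0 in auto)
      then have "qdd t = 0"
        using vector_derivative_unique_at has_vector_derivative_const by blast
      moreover have vt: "qd t = 0" using v0 t by simp
      ultimately have "Kp * (\<xi> \<bullet> e t + \<sigma> * norm (e t) * (\<xi> \<bullet> \<xi>)) = 0"
        using paired[OF t0 xi(2)[OF t0 vt]] by (simp add: eta_def)
      then have "\<xi> \<bullet> e t + \<sigma> * norm (e t) = 0"
        using gains xi(1) by (simp add: dot_square_norm)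
      moreover have "- norm (e t) \<le> \<xi> \<bullet> e t"
        using Cauchy_Schwarz_ineq2[of \<xi> "e t"] xi(1) by simp
      ultimately have "(\<sigma> - 1) * norm (e t) \<le> 0"
        by (simp add: algebra_simps)
      then show ?thesis
        using gains by (simp add: mult_le_0_iff)
    qed
    have "q t = qstar" "qd t = 0" if "t > T" for t
      using e0[OF that] v0[of t] that by (auto simp: e_def)
    then show ?thesis
      by (intro conjI tendsto_eventually eventually_mono[OF eventually_gt_at_top[of T]])
  next
    case False
    then have v_nz: "qd t \<noteq> 0" if "t \<ge> 0" for t using that by blast
    \<comment> \<open>\<open>V t + Kp * (e t \<bullet> e t)\<close> never increases, because its
      cross terms cancel those of \<open>- 2 * D t\<close>. As \<open>V\<close> is positive in this
      case, the initial value of the sum confines the error to this radius.\<close>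
    define r where "r = sqrt ((V 0 + Kp * (e 0 \<bullet> e 0)) / Kp)"
    have W: "((\<lambda>t. V t + Kp * (e t \<bullet> e t)) has_real_derivative
        (- 2 * D t + Kp * (e t \<bullet> qd t + qd t \<bullet> e t))) (at t within {0..})" if t: "t \<ge> 0" for t
    proof -
      have "((\<lambda>t. e t \<bullet> e t) has_real_derivative (e t \<bullet> qd t + qd t \<bullet> e t)) (at t within {0..})"
        unfolding has_real_derivative_iff_has_vector_derivative
        using bounded_bilinear.has_vector_derivative[OF bounded_bilinear_inner e[OF t] e[OF t]] .
      then show ?thesis
        by (intro DERIV_add DERIV_cmult V[OF t])
    qed
    have W_le: "- 2 * D t + Kp * (e t \<bullet> qd t + qd t \<bullet> e t) \<le> 0" for t
    proof -
      have "- 2 * D t + Kp * (e t \<bullet> qd t + qd t \<bullet> e t) =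
          - 2 * (Kp * (\<sigma> * norm (e t) * norm (qd t)) + Kd * (norm (qd t))\<^sup>2)"
        unfolding D_def inner_commute[of "e t" "qd t"] by algebra
      moreover have "0 \<le> Kp * (\<sigma> * norm (e t) * norm (qd t)) + Kd * (norm (qd t))\<^sup>2"
        using gains by simp
      ultimately show ?thesis by (simp only: mult_nonpos_nonneg)
    qed
    have e_bound: "norm (e t) \<le> r" if t: "t \<ge> 0" for t
    proof -
      have "V t + Kp * (e t \<bullet> e t) - (V 0 + Kp * (e 0 \<bullet> e 0)) \<le> 0 * (t - 0)"
        using derivative_le_imp_diff_le[OF W order_refl t W_le] .
      then have "Kp * (e t \<bullet> e t) \<le> V 0 + Kp * (e 0 \<bullet> e 0)"
        using V_pos[OF v_nz[OF t]] by simp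
      then have "(norm (e t))\<^sup>2 \<le> (V 0 + Kp * (e 0 \<bullet> e 0)) / Kp"
        using gains by (simp add: dot_square_norm field_simps)
      then show ?thesis
        unfolding r_def using real_le_rsqrt by blast
    qed
    have "r \<ge> 0" using e_bound[of 0] norm_ge_zero[of "e 0"] by linarith
    \<comment> \<open>The trajectory stays in this compact ball, over which the inertia bounds are
      uniform.\<close>
    have "continuous_on (cball qstar r) M"
      by (intro continuous_at_imp_continuous_on ballI differentiable_imp_continuous_within inertia(2))
    then obtain m k where mk: "m > 0" "k > 0"
        "\<And>x v. x \<in> cball qstar r \<Longrightarrow> m * (norm v)\<^sup>2 \<le> v \<bullet> (M x *v v)"
        "\<And>x v. x \<in> cball qstar r \<Longrightarrow> v \<bullet> (M x *v v) \<le> k * (norm v)\<^sup>2"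
      using quadratic_form_bounds[of "cball qstar r" M] inertia(1) \<open>r \<ge> 0\<close> by auto
    have q_in: "q t \<in> cball qstar r" if "t \<ge> 0" for t
      using e_bound[OF that] by (simp add: e_def dist_norm norm_minus_commute)
    define s where "s t = sqrt (V t)" for t
    have s_le: "s t \<le> sqrt k * norm (qd t)" if "t \<ge> 0" for t
      using real_sqrt_le_mono[OF mk(4)[OF q_in[OF that], of "qd t"]]
      by (simp add: s_def V_def real_sqrt_mult)
    have s_ge: "sqrt m * norm (qd t) \<le> s t" if "t \<ge> 0" for t
      using real_sqrt_le_mono[OF mk(3)[OF q_in[OF that], of "qd t"]]
      by (simp add: s_def V_def real_sqrt_mult)
    have s_pos: "s t > 0" if "t \<ge> 0" for t
      using V_pos[OF v_nz[OF that]] by (simp add: s_def)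
    have s: "(s has_real_derivative - (D t / s t)) (at t within {0..})" if t: "t \<ge> 0" for t
      unfolding s_def using V_pos[OF v_nz[OF t]]
      by (auto intro!: derivative_eq_intros V[OF t] simp: field_simps)
    \<comment> \<open>Dividing by \<open>s t\<close> absorbs the speed factor of
      \<open>D_ge\<close>, since the speed is at least \<open>s t / sqrt k\<close>. The decay rate
      of \<open>s\<close> therefore keeps a term in \<open>norm (e t)\<close> alone.\<close>
    have decay: "- (D t / s t) \<le> - (Kp * (\<sigma> - 1) / sqrt k) * norm (e t) - (Kd / sqrt k) * norm (qd t)"
      if t: "t \<ge> 0" for t
    proof -
      define a where "a = Kp * (\<sigma> - 1) * norm (e t) + Kd * norm (qd t)"
      have "a \<ge> 0" using gains by (simp add: a_def)
      have "a / sqrt k * s t \<le> a / sqrt k * (sqrt k * norm (qd t))"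
        using s_le[OF t] \<open>a \<ge> 0\<close> mk by (intro mult_left_mono) auto
      also have "\<dots> \<le> D t"
        using D_ge[of t] mk by (simp add: a_def)
      finally have "a / sqrt k \<le> D t / s t"
        using s_pos[OF t] by (simp add: pos_le_divide_eq)
      then show ?thesis
        by (simp add: a_def add_divide_distrib)
    qed
    have coeffs: "Kp * (\<sigma> - 1) / sqrt k > 0" "Kd / sqrt k > 0" "sqrt k > 0"
      using gains mk by auto
    note lims = dissipation_tendsto_zero[OF e s s_pos coeffs decay s_le]
    have "((\<lambda>t. e t + qstar) \<longlongrightarrow> 0 + qstar) at_top"
      by (intro tendsto_intros lims)
    then have "(q \<longlongrightarrow> qstar) at_top"
      by (simp add: e_def)
    \<comment> \<open>The lower inertia bound carries the decay of \<open>s\<close> over to the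
      speed.\<close>
    moreover have "(qd \<longlongrightarrow> 0) at_top"
    proof (rule Lim_null_comparison)
      show "\<forall>\<^sub>F t in at_top. norm (qd t) \<le> s t / sqrt m"
        using eventually_ge_at_top[of 0]
        by eventually_elim (use s_ge mk in \<open>simp add: field_simps\<close>)
      show "((\<lambda>t. s t / sqrt m) \<longlongrightarrow> 0) at_top"
        using tendsto_divide[OF lims(1) tendsto_const, of "sqrt m"] mk by simp
    qed
    ultimately show ?thesis ..
  qed
qed

end
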